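(* Let $X,Y$ be sets, let $a$ be an injective partial function from $Y$ to $X$, and let $\alpha=\operatorname{rank}(a)$. (i) If $\alpha<|Y|\leq|X|\leq\aleph_0$, then $\displaystyle\operatorname{rank}(\mathcal I_{XY}^a)=\sum_{\mu=\alpha+1}^{|Y|}\mu!\binom{|X|}{\mu}\binom{|Y|}{\mu}$. (ii) If $\alpha=|Y|<|X|\leq\aleph_0$, then $\operatorname{rank}(\mathcal I_{XY}^a)=\binom{|X|}{|Y|}+\begin{cases}0&\text{if }\alpha\leq2\\1&\text{if }\alpha\geq3.\end{cases}$
   Context: Maps are written on the right and composed left to right. $\mathcal I_{XY}$ is the set of all injective partial functions from $X$ to $Y$ (injective functions $C\to Y$ with $C\subseteq X$, including the empty map); $\mathcal I_{XY}^a$ is the sandwich semigroup $(\mathcal I_{XY},\star_a)$ with $f\star_ag=fag$. For a partial function, $\operatorname{rank}(a)=|\operatorname{im}(a)|$; for a semigroup $T$, $\operatorname{rank}(T)$ is the least cardinality of a generating set (as a semigroup). For cardinals $\mu\leq\kappa$, $\binom\kappa\mu$ is the number of subsets of size $\mu$ of a set of size $\kappa$ and $\mu!$ is the number of permutations of a set of size $\mu$ (for infinite $\kappa$, $\binom\kappa\mu=\kappa^\mu$ and $\kappa!=2^\kappa$). The sum in (i) is over all cardinals $\mu$ with $\alpha+1\leq\mu\leq|Y|$. *)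

theory Defs
  imports Main "HOL-Combinatorics.Permutations"
begin

unbundle cardinal_syntax

inductive_set generated :: "('s \<Rightarrow> 's \<Rightarrow> 's) \<Rightarrow> 's set \<Rightarrow> 's set"
  for m :: "'s \<Rightarrow> 's \<Rightarrow> 's" and A :: "'s set" where
  incl: "s \<in> A \<Longrightarrow> s \<in> generated m A"
| mult: "s \<in> generated m A \<Longrightarrow> t \<in> generated m A \<Longrightarrow> m s t \<in> generated m A"

definition generates :: "('s \<Rightarrow> 's \<Rightarrow> 's) \<Rightarrow> 's set \<Rightarrow> 's set \<Rightarrow> bool" where
  "generates m T A \<longleftrightarrow> A \<subseteq> T \<and> generated m A = T"

text \<open>A cardinal is a \<^const>\<open>Card_order\<close>, determined only up to \<open>=o\<close>; hence an
  arbitrary choice among the generating sets of least cardinality is harmless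
  (see \<open>semigroup_rank_eq\<close>).\<close>

definition semigroup_rank :: "('s \<Rightarrow> 's \<Rightarrow> 's) \<Rightarrow> 's set \<Rightarrow> 's rel" where
  "semigroup_rank m T =
     |SOME A. generates m T A \<and> (\<forall>B. generates m T B \<longrightarrow> |A| \<le>o |B| )|"

lemma semigroup_rank_least:
  assumes closed: "\<And>s t. s \<in> T \<Longrightarrow> t \<in> T \<Longrightarrow> m s t \<in> T"
  shows "\<exists>A. generates m T A \<and> semigroup_rank m T = |A| \<and> (\<forall>B. generates m T B \<longrightarrow> |A| \<le>o |B| )"
proof -
  have "generated m T \<subseteq> T"
  proof
    fix s assume "s \<in> generated m T"
    then show "s \<in> T" by induction (auto intro: closed)
  qed
  then have "generates m T T" by (auto simp: generates_def intro: generated.incl)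
  then have "\<exists>r \<in> card_of ` {A. generates m T A}. \<forall>r' \<in> card_of ` {A. generates m T A}. r \<le>o r'"
    by (intro exists_minim_Card_order) (auto simp: card_of_Card_order)
  then have "\<exists>A. generates m T A \<and> (\<forall>B. generates m T B \<longrightarrow> |A| \<le>o |B| )" by auto
  from someI_ex[OF this] show ?thesis unfolding semigroup_rank_def by blast
qed

lemma semigroup_rank_eq:
  assumes A: "generates m T A" and least: "\<And>B. generates m T B \<Longrightarrow> |A| \<le>o |B|"
  shows "semigroup_rank m T =o |A|"
proof -
  define P where "P = (\<lambda>A. generates m T A \<and> (\<forall>B. generates m T B \<longrightarrow> |A| \<le>o |B| ))"
  have "P A" using assms by (simp add: P_def)
  then have "P (Eps P)" by (rule someI)
  then have "|Eps P| \<le>o |A|" "|A| \<le>o |Eps P|" using assms by (simp_all add: P_def)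
  then show ?thesis
    unfolding semigroup_rank_def P_def[symmetric] ordIso_iff_ordLeq by (rule conjI)
qed

definition pinj :: "'x set \<Rightarrow> 'y set \<Rightarrow> ('x \<rightharpoonup> 'y) set" where
  "pinj X Y = {f. dom f \<subseteq> X \<and> ran f \<subseteq> Y \<and> inj_on f (dom f)}"

definition map_rank :: "('x \<rightharpoonup> 'y) \<Rightarrow> 'y rel" where
  "map_rank f = |ran f|"

text \<open>The product \<open>f a g\<close> means first \<open>f\<close>, then \<open>a\<close>, then \<open>g\<close>.\<close>

definition sandwich :: "('y \<rightharpoonup> 'x) \<Rightarrow> ('x \<rightharpoonup> 'y) \<Rightarrow> ('x \<rightharpoonup> 'y) \<Rightarrow> ('x \<rightharpoonup> 'y)" where
  "sandwich a f g = g \<circ>\<^sub>m a \<circ>\<^sub>m f"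

lemma pinj_comp: "f \<in> pinj X Y \<Longrightarrow> g \<in> pinj Y Z \<Longrightarrow> g \<circ>\<^sub>m f \<in> pinj X Z"
proof -
  assume "f \<in> pinj X Y" and "g \<in> pinj Y Z"
  then have f: "dom f \<subseteq> X" "inj_on f (dom f)" and g: "ran g \<subseteq> Z" "inj_on g (dom g)"
    by (auto simp: pinj_def)
  have "dom (g \<circ>\<^sub>m f) \<subseteq> X" using f(1) by (fastforce simp: map_comp_Some_iff dom_def)
  moreover have "ran (g \<circ>\<^sub>m f) \<subseteq> Z" using g(1) by (auto simp: ran_def map_comp_Some_iff)
  moreover have "inj_on (g \<circ>\<^sub>m f) (dom (g \<circ>\<^sub>m f))"
  proof (rule inj_onI)
    fix x x' assume x: "x \<in> dom (g \<circ>\<^sub>m f)" and eq: "(g \<circ>\<^sub>m f) x = (g \<circ>\<^sub>m f) x'"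
    obtain z where z: "(g \<circ>\<^sub>m f) x = Some z" using domD[OF x] by (elim exE)
    with eq have z': "(g \<circ>\<^sub>m f) x' = Some z" by simp
    obtain y where y1: "f x = Some y" "g y = Some z"
      using z unfolding map_comp_Some_iff by (elim exE conjE)
    obtain y' where y2: "f x' = Some y'" "g y' = Some z"
      using z' unfolding map_comp_Some_iff by (elim exE conjE)
    note y = y1 y2
    have "y = y'" using inj_onD[OF g(2), of y y'] y by (simp add: domI)
    with y show "x = x'" using inj_onD[OF f(2), of x x'] by (simp add: domI)
  qed
  ultimately show ?thesis by (simp add: pinj_def)
qed

lemma sandwich_closed:
  "a \<in> pinj Y X \<Longrightarrow> f \<in> pinj X Y \<Longrightarrow> g \<in> pinj X Y \<Longrightarrow> sandwich a f g \<in> pinj X Y"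
  unfolding sandwich_def by (meson pinj_comp)

lemma sandwich_assoc: "sandwich a (sandwich a f g) h = sandwich a f (sandwich a g h)"
  by (auto simp: sandwich_def map_comp_def fun_eq_iff split: option.splits)

text \<open>For a cardinal \<open>\<kappa>\<close>, each cardinal \<open>\<mu> \<le> \<kappa>\<close> is represented by exactly
  one initial segment of the well-order \<open>\<kappa>\<close> (see \<open>cardinals_upto_unique\<close>), so
  indexing a sum by these initial segments counts every cardinal once.\<close>

definition cardinals_upto :: "'b rel \<Rightarrow> 'b rel set" where
  "cardinals_upto \<kappa> = {Restr \<kappa> S | S. wo_rel.ofilter \<kappa> S \<and> Card_order (Restr \<kappa> S)}"

lemma cardinals_upto_unique:
  fixes \<kappa> :: "'b rel" and \<mu> :: "'c rel"
  assumes \<kappa>: "Card_order \<kappa>" and \<mu>: "Card_order \<mu>" and le: "\<mu> \<le>o \<kappa>"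
  shows "\<exists>!\<nu>. \<nu> \<in> cardinals_upto \<kappa> \<and> \<nu> =o \<mu>"
proof -
  have W: "Well_order \<kappa>" "Well_order \<mu>" using \<kappa> \<mu> by (auto simp: card_order_on_def)
  from le obtain f where f: "embed \<mu> \<kappa> f" unfolding ordLeq_def by blast
  have of: "wo_rel.ofilter \<kappa> (f ` Field \<mu>)" using embed_Field_ofilter[OF W(2,1) f] .
  have "\<mu> =o Restr \<kappa> (f ` Field \<mu>)"
    using embed_implies_iso_Restr[OF W f] W Well_order_Restr unfolding ordIso_def by blast
  then have iso: "Restr \<kappa> (f ` Field \<mu>) =o \<mu>" by (rule ordIso_symmetric)
  then have "Card_order (Restr \<kappa> (f ` Field \<mu>))" using \<mu> Card_order_ordIso by blast
  then have "Restr \<kappa> (f ` Field \<mu>) \<in> cardinals_upto \<kappa>" using of unfolding cardinals_upto_def by blast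
  moreover have "\<nu> = \<nu>'"
    if "\<nu> \<in> cardinals_upto \<kappa>" "\<nu> =o \<mu>" "\<nu>' \<in> cardinals_upto \<kappa>" "\<nu>' =o \<mu>" for \<nu> \<nu>'
  proof -
    obtain S S' where S: "\<nu> = Restr \<kappa> S" "wo_rel.ofilter \<kappa> S" "\<nu>' = Restr \<kappa> S'" "wo_rel.ofilter \<kappa> S'"
      using \<open>\<nu> \<in> cardinals_upto \<kappa>\<close> \<open>\<nu>' \<in> cardinals_upto \<kappa>\<close> unfolding cardinals_upto_def by blast
    have "\<nu> =o \<nu>'" using that ordIso_symmetric ordIso_transitive by blast
    then have "S = S'"
      using S ofilter_subset_ordLeq[OF W(1)] unfolding ordIso_iff_ordLeq by blast
    then show ?thesis using S by simp
  qed
  ultimately show ?thesis using iso by blast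
qed

definition card_sum :: "'i set \<Rightarrow> ('i \<Rightarrow> 'b rel) \<Rightarrow> ('i \<times> 'b) rel" where
  "card_sum I \<kappa> = |SIGMA i : I. Field (\<kappa> i)|"

definition card_binomial :: "'a rel \<Rightarrow> 'b rel \<Rightarrow> 'a set rel" where
  "card_binomial \<kappa> \<mu> = |{A. A \<subseteq> Field \<kappa> \<and> |A| =o \<mu>}|"

definition card_fact :: "'b rel \<Rightarrow> ('b \<Rightarrow> 'b) rel" where
  "card_fact \<mu> = |{p. p permutes Field \<mu>}|"

end

theory Submission
  imports Defs "HOL-Combinatorics.Cycles"
begin

text \<open>A product has rank at most \<open>\<alpha>\<close>, so if \<open>\<alpha> < |Y|\<close> every generating set contains all elements
  of rank above \<open>\<alpha>\<close>. These suffice: an element of finite rank \<open>r \<le> \<alpha>\<close>, \<open>r < |Y|\<close>, is a product of two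
  elements of rank \<open>r + 1\<close>, obtained by adding to each factor one pair that is lost in the product.

  If \<open>\<alpha> = |Y|\<close>, then \<open>Y\<close> is finite and, by the same factorisation, only the elements of rank \<open>|Y|\<close>
  matter. A product of rank \<open>|Y|\<close> has the domain of its first factor, so each \<open>|Y|\<close>-subset of \<open>X\<close> is
  the domain of a generator. Elements with a common domain differ by a right factor with domain
  \<open>im a\<close>, and those factors form a copy of the symmetric group on \<open>Y\<close>, which needs one
  generator if \<open>|Y| \<le> 2\<close> and two otherwise.\<close>

section \<open>Partial injections\<close>

lemma pinj_bij_betw:
  assumes "f \<in> pinj X Y"
  shows "bij_betw (the \<circ> f) (dom f) (ran f)"
  using assms unfolding pinj_def bij_betw_def inj_on_def
  by (auto simp: ran_def dom_def image_iff intro: rev_image_eqI)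

lemma pinj_finite_ran:
  assumes "f \<in> pinj X Y"
  shows "finite (dom f) = finite (ran f)" and "card (dom f) = card (ran f)"
    and "|dom f| =o |ran f|"
  using bij_betw_finite[OF pinj_bij_betw[OF assms]] bij_betw_same_card[OF pinj_bij_betw[OF assms]]
    card_of_ordIsoI[OF pinj_bij_betw[OF assms]] .

lemma pinj_same: "f \<in> pinj X Y \<Longrightarrow> f x = Some y \<Longrightarrow> f x' = Some y \<Longrightarrow> x = x'"
  by (auto simp: pinj_def dest!: inj_onD[where x = x and y = x'])

lemma pinjI:
  assumes "\<And>x y. f x = Some y \<Longrightarrow> x \<in> X \<and> y \<in> Y"
    and "\<And>x x' y. f x = Some y \<Longrightarrow> f x' = Some y \<Longrightarrow> x = x'"
  shows "f \<in> pinj X Y"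
  using assms unfolding pinj_def inj_on_def by (auto simp: ran_def dom_def)

text \<open>Choice gives a definition for every partial map; on a partial injection it is the
  converse relation, as \<open>pinv_Some_iff\<close> records.\<close>

definition pinv :: "('y \<rightharpoonup> 'x) \<Rightarrow> ('x \<rightharpoonup> 'y)" where
  "pinv f x = (if \<exists>y. f y = Some x then Some (SOME y. f y = Some x) else None)"

lemma pinv_Some_iff:
  assumes "f \<in> pinj X Y"
  shows "pinv f y = Some x \<longleftrightarrow> f x = Some y"
proof
  assume "pinv f y = Some x"
  then show "f x = Some y"
    unfolding pinv_def by (auto split: if_splits intro: someI)
next
  assume "f x = Some y"
  moreover from this have "(SOME y'. f y' = Some y) = x"
    by (metis (mono_tags, lifting) assms pinj_same someI)
  ultimately show "pinv f y = Some x" unfolding pinv_def by auto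
qed

lemma dom_pinv: "f \<in> pinj X Y \<Longrightarrow> dom (pinv f) = ran f"
  by (auto simp: dom_def ran_def pinv_Some_iff)

lemma pinv_pinj: "f \<in> pinj X Y \<Longrightarrow> pinv f \<in> pinj Y X"
  by (rule pinjI) (auto simp: pinv_Some_iff, auto simp: pinj_def ran_def)

lemma pinj_upd:
  assumes "f \<in> pinj X Y" "x \<in> X" "y \<in> Y" "y \<notin> ran f"
  shows "f(x \<mapsto> y) \<in> pinj X Y"
  using assms by (intro pinjI) (auto split: if_splits simp: pinj_def ran_def inj_on_def dom_def)

section \<open>Factoring an element into factors of larger rank\<close>

text \<open>Let \<open>g\<close> send \<open>dom f\<close> bijectively onto a set \<open>D\<close>
  inside \<open>dom a\<close>, and let \<open>h\<close> lead from the image of \<open>D\<close>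
  under \<open>a\<close> back to the values of \<open>f\<close>. Each factor then receives one more
  pair: that of \<open>h\<close> starts outside \<open>ran a\<close>, that of \<open>g\<close> ends
  outside \<open>D\<close>, so neither contributes to the product.\<close>

lemma sandwich_factor:
  fixes a :: "'y \<rightharpoonup> 'x"
  assumes a: "a \<in> pinj Y X" and x1: "x1 \<in> X" "x1 \<notin> ran a"
    and f: "f \<in> pinj X Y" and finf: "finite (ran f)"
    and le: "card (ran f) \<le> card (ran a)" and ne: "ran f \<noteq> Y"
  shows "\<exists>g\<in>pinj X Y. \<exists>h\<in>pinj X Y. f = sandwich a g h \<and>
    card (ran g) = Suc (card (ran f)) \<and> card (ran h) = Suc (card (ran f))"
proof -
  have ranfY: "ran f \<subseteq> Y" and domf: "dom f \<subseteq> X" using f by (auto simp: pinj_def)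
  obtain y1 where y1: "y1 \<in> Y" "y1 \<notin> ran f" using ranfY ne by blast
  have "card (ran f) \<le> card (dom a)" using le pinj_finite_ran(2)[OF a] by simp
  then obtain D where D: "D \<subseteq> dom a" "card D = card (ran f)" "finite D"
    by (rule obtain_subset_with_card_n)
  have "D \<noteq> Y"
  proof
    assume "D = Y"
    then have "card (ran f) < card D"
      using D(3) ranfY ne by (intro psubset_card_mono) auto
    then show False using D(2) by simp
  qed
  moreover have "D \<subseteq> Y" using D(1) a by (auto simp: pinj_def)
  ultimately obtain y0 where y0: "y0 \<in> Y" "y0 \<notin> D" by blast
  \<comment> \<open>\<open>X\<close> has more than \<open>card (ran a)\<close> points, because
    \<open>x1\<close> lies outside \<open>ran a\<close>, while \<open>dom f\<close> has at most that
    many.\<close>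
  have "\<not> X \<subseteq> dom f"
  proof
    assume "X \<subseteq> dom f"
    moreover have "ran a \<subset> X" using a x1 by (auto simp: pinj_def)
    ultimately have "card (ran a) < card (dom f)"
      using finf pinj_finite_ran(1)[OF f] by (intro psubset_card_mono) auto
    then show False using le pinj_finite_ran(2)[OF f] by simp
  qed
  then obtain x0 where x0: "x0 \<in> X" "x0 \<notin> dom f" by blast
  obtain e where e: "bij_betw e (dom f) D"
    using finite_same_card_bij[of "dom f" D] D pinj_finite_ran[OF f] finf by auto
  define g where "g = (\<lambda>x. if x \<in> dom f then Some (e x) else None)"
  have g: "g \<in> pinj X Y"
    using e \<open>D \<subseteq> Y\<close> domf unfolding g_def
    by (intro pinjI) (auto split: if_splits simp: bij_betw_def inj_on_def)
  have domg: "dom g = dom f" by (auto simp: g_def dom_def split: if_splits)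
  have rang: "ran g = D" using e unfolding g_def
    by (auto simp: ran_def bij_betw_def split: if_splits)
  have ginv: "pinv g \<in> pinj Y X" using g by (rule pinv_pinj)
  \<comment> \<open>From left to right: the inverse of \<open>a\<close>, the inverse of
    \<open>g\<close>, then \<open>f\<close>. Its domain is the image of \<open>D\<close> under
    \<open>a\<close>.\<close>
  define h where "h = f \<circ>\<^sub>m pinv g \<circ>\<^sub>m pinv a"
  have h: "h \<in> pinj X Y" unfolding h_def
    using pinj_comp[OF pinv_pinj[OF a] pinj_comp[OF ginv f]]
    by (simp add: map_comp_def)
  have h_iff: "h x = Some y \<longleftrightarrow> (\<exists>z u. a u = Some x \<and> g z = Some u \<and> f z = Some y)" for x y
    unfolding h_def by (auto simp: map_comp_Some_iff pinv_Some_iff[OF a] pinv_Some_iff[OF g])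
  have ranh: "ran h = ran f"
  proof
    show "ran h \<subseteq> ran f" by (auto simp: ran_def h_iff)
    show "ran f \<subseteq> ran h"
    proof
      fix y assume "y \<in> ran f"
      then obtain z where z: "f z = Some y" by (auto simp: ran_def)
      then obtain u where u: "g z = Some u" using domg by blast
      then have "u \<in> D" using rang by (auto simp: ran_def)
      then obtain x where "a u = Some x" using D(1) by auto
      then show "y \<in> ran h" using z u by (auto simp: ran_def h_iff)
    qed
  qed
  have "x1 \<notin> dom h" using x1 by (auto simp: h_iff ran_def)
  then have "card (ran (h(x1 \<mapsto> y1))) = Suc (card (ran f))"
    using ranh y1 finf by (auto simp: dom_def)
  moreover have "x0 \<notin> dom g" using x0 domg by simp
  then have "card (ran (g(x0 \<mapsto> y0))) = Suc (card (ran f))"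
    using rang y0 D by (auto simp: dom_def)
  moreover have "g(x0 \<mapsto> y0) \<in> pinj X Y" "h(x1 \<mapsto> y1) \<in> pinj X Y"
    using g h x0 y0 x1 y1 rang ranh by (auto intro!: pinj_upd)
  \<comment> \<open>The pair at \<open>x1\<close> is never reached through \<open>a\<close>. As
    \<open>a\<close> is injective and \<open>y0\<close> is not in \<open>D\<close>, the point
    \<open>a y0\<close>, if it exists, is not in \<open>dom h\<close>.\<close>
  moreover have "sandwich a (g(x0 \<mapsto> y0)) (h(x1 \<mapsto> y1)) z = Some y \<longleftrightarrow> f z = Some y" for z y
  proof -
    have x1a: "a u \<noteq> Some x1" for u using x1 by (auto simp: ran_def)
    have "sandwich a (g(x0 \<mapsto> y0)) (h(x1 \<mapsto> y1)) z = Some y \<longleftrightarrow>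
      (\<exists>u x. (g(x0 \<mapsto> y0)) z = Some u \<and> a u = Some x \<and> h x = Some y)"
      unfolding sandwich_def map_comp_Some_iff using x1a by (metis fun_upd_other)
    also have "\<dots> \<longleftrightarrow> f z = Some y"
    proof
      assume "\<exists>u x. (g(x0 \<mapsto> y0)) z = Some u \<and> a u = Some x \<and> h x = Some y"
      then obtain u x z' u' where *: "(g(x0 \<mapsto> y0)) z = Some u" "a u = Some x" "a u' = Some x"
        "g z' = Some u'" "f z' = Some y" by (auto simp: h_iff)
      then have "u' = u" using pinj_same[OF a] by blast
      moreover have "u' \<in> D" using rang *(4) by (auto simp: ran_def)
      ultimately have "g z = Some u" using * y0 by (auto split: if_splits)
      then have "z = z'" using * \<open>u' = u\<close> pinj_same[OF g] by blast
      then show "f z = Some y" using * by simp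
    next
      assume z: "f z = Some y"
      then obtain u where u: "g z = Some u" using domg by blast
      then have "u \<in> D" using rang by (auto simp: ran_def)
      then obtain x where "a u = Some x" using D(1) by auto
      moreover have "z \<noteq> x0" using z x0 by auto
      ultimately show "\<exists>u x. (g(x0 \<mapsto> y0)) z = Some u \<and> a u = Some x \<and> h x = Some y"
        using z u by (auto simp: h_iff)
    qed
    finally show ?thesis .
  qed
  then have "f = sandwich a (g(x0 \<mapsto> y0)) (h(x1 \<mapsto> y1))"
    by (intro ext) (metis not_Some_eq)
  ultimately show ?thesis by blast
qed

text \<open>By \<open>sandwich_factor\<close>, an element excluded from \<open>top\<close> is a
  product of two elements whose rank is larger by one. Climbing in rank ends at elements to which
  \<open>top\<close> applies.\<close>

lemma generates_pinjI:
  fixes a :: "'y \<rightharpoonup> 'x"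
  assumes a: "a \<in> pinj Y X" and ne: "ran a \<noteq> X"
    and G: "G \<subseteq> pinj X Y"
    and top: "\<And>f. f \<in> pinj X Y \<Longrightarrow>
      \<not> (finite (ran f) \<and> card (ran f) \<le> card (ran a) \<and> ran f \<noteq> Y) \<Longrightarrow>
      f \<in> generated (sandwich a) G"
  shows "generates (sandwich a) (pinj X Y) G"
proof -
  obtain x1 where x1: "x1 \<in> X" "x1 \<notin> ran a" using a ne by (auto simp: pinj_def)
  have "f \<in> generated (sandwich a) G" if "f \<in> pinj X Y" for f
    using that
  \<comment> \<open>The measure falls as the rank grows; \<open>Suc\<close> keeps the fall strict
    when the rank equals \<open>card (ran a)\<close>.\<close>
  proof (induction "Suc (card (ran a)) - card (ran f)" arbitrary: f rule: less_induct)
    case less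
    show ?case
    proof (cases "finite (ran f) \<and> card (ran f) \<le> card (ran a) \<and> ran f \<noteq> Y")
      case True
      then obtain g h where "g \<in> pinj X Y" "h \<in> pinj X Y" "f = sandwich a g h"
        "card (ran g) = Suc (card (ran f))" "card (ran h) = Suc (card (ran f))"
        using sandwich_factor[OF a x1 less.prems] by blast
      moreover from this True have "g \<in> generated (sandwich a) G" "h \<in> generated (sandwich a) G"
        using less.hyps by auto
      ultimately show ?thesis by (auto intro: generated.mult)
    next
      case False
      then show ?thesis using top less.prems by blast
    qed
  qed
  moreover have "f \<in> pinj X Y" if "f \<in> generated (sandwich a) G" for f
    using that by induction (use G a sandwich_closed in blast)+
  ultimately show ?thesis using G by (auto simp: generates_def)
qed

section \<open>Finite cardinals\<close>

lemma card_of_ordLeq_card: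
  "finite A \<Longrightarrow> finite B \<Longrightarrow> |A| \<le>o |B| \<longleftrightarrow> card A \<le> card B"
  by (metis card_of_ordLeq inj_on_iff_card_le)

lemma card_of_ordLess_card:
  "finite A \<Longrightarrow> finite B \<Longrightarrow> |A| <o |B| \<longleftrightarrow> card A < card B"
  using card_of_ordLeq_card[of B A] by (simp add: not_ordLeq_iff_ordLess[symmetric] not_le[symmetric] card_of_Well_order)

lemma finite_ordLess_iff:
  assumes "finite A"
  shows "|A| <o |B| \<longleftrightarrow> infinite B \<or> card A < card B"
proof (cases "finite B")
  case True
  then show ?thesis using assms by (simp add: card_of_ordLess_card)
next
  case False
  then show ?thesis
    using assms finite_ordLess_infinite[OF card_of_Well_order card_of_Well_order, of A B]
    by (simp add: Field_card_of)
qed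

lemma finite_of_ordLess_natLeq:
  assumes "|A| <o |B|" "|B| \<le>o natLeq"
  shows "finite A"
  unfolding finite_iff_ordLess_natLeq using assms by (rule ordLess_ordLeq_trans)

text \<open>Turns the lower limit of the sum into a strict inequality. Finiteness matters, since an
  infinite cardinal absorbs the added 1.\<close>

lemma csum_cone_ordLeq_iff:
  assumes "finite A"
  shows "|A| +c cone \<le>o |B| \<longleftrightarrow> |A| <o |B|"
proof -
  have eq: "|A| +c cone = |A <+> (UNIV :: unit set)|"
    by (simp add: csum_def cone_def Field_card_of UNIV_unit)
  have fin: "finite (A <+> (UNIV :: unit set))" and "card (A <+> (UNIV :: unit set)) = Suc (card A)"
    using assms by (auto simp: card_Plus)
  then show ?thesis
    unfolding eq finite_ordLess_iff[OF assms]
    using card_of_ordLeq_card[OF fin, of B] finite_ordLess_iff[OF fin, of B] ordLess_imp_ordLeq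
    by (cases "finite B") auto
qed

section \<open>The case of rank less than the size of the target\<close>

text \<open>With \<open>R = ran a\<close> these elements are out of reach of any product; they form
  the least generating set in part (i).\<close>

definition high_rank :: "'z set \<Rightarrow> 'x set \<Rightarrow> 'y set \<Rightarrow> ('x \<rightharpoonup> 'y) set" where
  "high_rank R X Y = {f \<in> pinj X Y. |R| <o |ran f| }"

lemma ran_sandwich_le:
  "|ran (sandwich a f g)| \<le>o |ran a|"
proof -
  have "ran (sandwich a f g) \<subseteq> (the \<circ> g) ` ran a"
    by (force simp: ran_def sandwich_def map_comp_Some_iff image_iff)
  then show ?thesis by (meson card_of_image card_of_mono1 ordLeq_transitive)
qed

text \<open>Such an element is not a product by \<open>ran_sandwich_le\<close>, so it can only enter
  the generated set as a generator.\<close>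

lemma high_rank_subset_generates:
  assumes B: "generates (sandwich a) (pinj X Y) B"
  shows "high_rank (ran a) X Y \<subseteq> B"
proof
  fix f assume f: "f \<in> high_rank (ran a) X Y"
  then have "f \<in> generated (sandwich a) B" using B by (auto simp: generates_def high_rank_def)
  then show "f \<in> B"
  proof cases
    case (mult s t)
    then have "|ran f| \<le>o |ran a|" using ran_sandwich_le by metis
    then show ?thesis using f not_ordLess_ordLeq unfolding high_rank_def by blast
  qed
qed

text \<open>What \<open>generates_pinjI\<close> leaves over has rank above that of \<open>a\<close>:
  this covers the elements onto \<open>Y\<close> too, because \<open>Y\<close> is larger than
  \<open>ran a\<close>.\<close>

lemma high_rank_generates:
  assumes a: "a \<in> pinj Y X" and fin: "finite (ran a)"
    and Y: "|ran a| <o |Y|" and X: "|Y| \<le>o |X|"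
  shows "generates (sandwich a) (pinj X Y) (high_rank (ran a) X Y)"
proof (rule generates_pinjI[OF a])
  have "|ran a| <o |X|" using Y X ordLess_ordLeq_trans by blast
  then show "ran a \<noteq> X" using ordLess_irreflexive[of "|X|"] by auto
  show "high_rank (ran a) X Y \<subseteq> pinj X Y" by (auto simp: high_rank_def)
  fix f assume f: "f \<in> pinj X Y" "\<not> (finite (ran f) \<and> card (ran f) \<le> card (ran a) \<and> ran f \<noteq> Y)"
  then have "ran f = Y \<or> infinite (ran f) \<or> card (ran a) < card (ran f)" by linarith
  then have "|ran a| <o |ran f|"
    using Y finite_ordLess_iff[OF fin, of "ran f"] by (elim disjE) simp_all
  then show "f \<in> generated (sandwich a) (high_rank (ran a) X Y)"
    using f by (auto simp: high_rank_def intro: generated.incl)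
qed

section \<open>Counting the elements of large rank\<close>

lemma cardinals_upto_Card_order: "\<mu> \<in> cardinals_upto \<kappa> \<Longrightarrow> Card_order \<mu>"
  by (auto simp: cardinals_upto_def)

text \<open>A partial injection of rank \<open>\<mu>\<close> amounts to its domain, its range and, through fixed
  bijections of \<open>\<mu>\<close> with these two sets, a permutation of \<open>\<mu>\<close>.\<close>

lemma card_of_high_rank:
  fixes X :: "'x set" and Y :: "'y set"
  assumes fin: "finite R"
  shows "card_sum {\<mu> \<in> cardinals_upto |Y|. |R| +c cone \<le>o \<mu>}
     (\<lambda>\<mu>. card_fact \<mu> *c card_binomial |X| \<mu> *c card_binomial |Y| \<mu>) =o |high_rank R X Y|"
proof -
  define I where "I = {\<mu> \<in> cardinals_upto |Y|. |R| <o \<mu>}"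
  have I: "{\<mu> \<in> cardinals_upto |Y|. |R| +c cone \<le>o \<mu>} = I"
  proof -
    have "|R| +c cone \<le>o \<mu> \<longleftrightarrow> |R| <o \<mu>" if "Card_order \<mu>" for \<mu> :: "'y rel"
      using csum_cone_ordLeq_iff[OF fin, of "Field \<mu>"] card_of_Field_ordIso[OF that]
      by (meson ordIso_ordLess_trans ordIso_symmetric ordLeq_ordIso_trans ordLess_ordIso_trans)
    then show ?thesis using cardinals_upto_Card_order unfolding I_def by blast
  qed
  \<comment> \<open>The sum of products becomes the cardinality of a set of quadruples: cardinal,
    permutation, domain, range.\<close>
  define S where "S = (SIGMA \<mu> : I. {p. p permutes Field \<mu>} \<times> {A. A \<subseteq> X \<and> |A| =o \<mu>} \<times> {B. B \<subseteq> Y \<and> |B| =o \<mu>})"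
  have S: "card_sum I (\<lambda>\<mu>. card_fact \<mu> *c card_binomial |X| \<mu> *c card_binomial |Y| \<mu>) = |S|"
    by (simp add: card_sum_def S_def cprod_def card_fact_def card_binomial_def Field_card_of)
  define e where "e = (\<lambda>(\<mu> :: 'y rel) (A :: 'x set). SOME h. bij_betw h A (Field \<mu>))"
  define d where "d = (\<lambda>(\<mu> :: 'y rel) (B :: 'y set). SOME h. bij_betw h (Field \<mu>) B)"
  have e: "bij_betw (e \<mu> A) A (Field \<mu>)" if "Card_order \<mu>" "|A| =o \<mu>" for \<mu> A
  proof -
    have "|A| =o |Field \<mu>|"
      using card_of_Field_ordIso that ordIso_symmetric ordIso_transitive by blast
    then have "\<exists>h. bij_betw h A (Field \<mu>)" by (simp add: card_of_ordIso)
    then show ?thesis unfolding e_def by (rule someI_ex)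
  qed
  have d: "bij_betw (d \<mu> B) (Field \<mu>) B" if "Card_order \<mu>" "|B| =o \<mu>" for \<mu> B
  proof -
    have "|Field \<mu>| =o |B|"
      using card_of_Field_ordIso that ordIso_symmetric ordIso_transitive by blast
    then have "\<exists>h. bij_betw h (Field \<mu>) B" by (simp add: card_of_ordIso)
    then show ?thesis unfolding d_def by (rule someI_ex)
  qed
  \<comment> \<open>The map goes from \<open>A\<close> to \<open>\<mu>\<close> by \<open>e\<close>,
    permutes there by \<open>p\<close> and continues to \<open>B\<close> by
    \<open>d\<close>.\<close>
  define F where "F = (\<lambda>(\<mu> :: 'y rel, p, A, B) x. if x \<in> A then Some (d \<mu> B (p (e \<mu> A x))) else None)"
  have bij: "bij_betw (\<lambda>x. d \<mu> B (p (e \<mu> A x))) A B"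
    if "Card_order \<mu>" "p permutes Field \<mu>" "|A| =o \<mu>" "|B| =o \<mu>" for \<mu> p A B
    using bij_betw_trans[OF bij_betw_trans[OF e permutes_imp_bij] d] that by (simp add: o_def)
  have dom: "dom (F (\<mu>, p, A, B)) = A" for \<mu> p A B
    by (auto simp: F_def dom_def)
  have ran: "ran (F (\<mu>, p, A, B)) = B"
    if "Card_order \<mu>" "p permutes Field \<mu>" "|A| =o \<mu>" "|B| =o \<mu>" for \<mu> p A B
  proof -
    have "ran (F (\<mu>, p, A, B)) = (\<lambda>x. d \<mu> B (p (e \<mu> A x))) ` A" by (auto simp: F_def ran_def)
    then show ?thesis using bij_betw_imp_surj_on[OF bij[OF that]] by simp
  qed
  have mem: "F (\<mu>, p, A, B) \<in> high_rank R X Y"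
    if "\<mu> \<in> I" "p permutes Field \<mu>" "A \<subseteq> X" "|A| =o \<mu>" "B \<subseteq> Y" "|B| =o \<mu>" for \<mu> p A B
  proof -
    have C: "Card_order \<mu>" using that cardinals_upto_Card_order by (auto simp: I_def)
    have "F (\<mu>, p, A, B) \<in> pinj X Y"
      using bij[OF C that(2,4,6)] that(3,5) by (intro pinjI) (auto simp: F_def bij_betw_def inj_on_def split: if_splits)
    moreover have "|R| <o |B|"
      using that ordLess_ordIso_trans ordIso_symmetric by (fastforce simp: I_def)
    ultimately show ?thesis by (simp add: high_rank_def ran[OF C that(2,4,6)])
  qed
  have "bij_betw F S (high_rank R X Y)"
  proof (rule bij_betwI')
    fix s t assume s: "s \<in> S" and t: "t \<in> S"
    obtain \<mu> p A B where s': "s = (\<mu>, p, A, B)" by (cases s)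
    obtain \<nu> q A' B' where t': "t = (\<nu>, q, A', B')" by (cases t)
    have s1: "\<mu> \<in> I" "p permutes Field \<mu>" "|A| =o \<mu>" "|B| =o \<mu>"
      and t1: "\<nu> \<in> I" "q permutes Field \<nu>" "|A'| =o \<nu>" "|B'| =o \<nu>" and B: "B \<subseteq> Y"
      using s t s' t' by (auto simp: S_def)
    have C: "Card_order \<mu>" "Card_order \<nu>"
      using s1 t1 cardinals_upto_Card_order by (auto simp: I_def)
    have "s = t" if FF: "F s = F t"
    proof -
      have A: "A' = A" and B': "B' = B"
        using FF dom ran[OF C(1) s1(2-4)] ran[OF C(2) t1(2-4)] s' t' by metis+
      \<comment> \<open>Both indices have the cardinality of \<open>B\<close>, and
        \<open>cardinals_upto\<close> holds one representative per cardinal.\<close>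
      have "\<mu> = \<nu>"
        using cardinals_upto_unique[OF card_of_Card_order card_of_Card_order card_of_mono1[OF B]]
          s1 t1 ordIso_symmetric unfolding A B' I_def by blast
      moreover have "p z = q z" for z
      proof (cases "z \<in> Field \<mu>")
        case True
        then obtain x where x: "x \<in> A" "z = e \<mu> A x"
          using e[OF C(1) s1(3)] by (auto simp: bij_betw_def)
        have "F s x = F t x" using FF by simp
        then have "d \<mu> B (p z) = d \<mu> B (q z)"
          using x \<open>\<mu> = \<nu>\<close> by (simp add: F_def s' t' A B')
        moreover have "p z \<in> Field \<mu>" "q z \<in> Field \<mu>"
          using True s1 t1 \<open>\<mu> = \<nu>\<close> permutes_in_image by metis+
        ultimately show ?thesis using d[OF C(1) s1(4)] by (auto simp: bij_betw_def inj_on_def)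
      next
        case False
        then show ?thesis using s1 t1 \<open>\<mu> = \<nu>\<close> by (simp add: permutes_def)
      qed
      ultimately show ?thesis using A B' s' t' by auto
    qed
    then show "(F s = F t) = (s = t)" by auto
  next
    fix s assume "s \<in> S"
    then show "F s \<in> high_rank R X Y" using mem by (auto simp: S_def)
  next
    fix f assume f: "f \<in> high_rank R X Y"
    then have fp: "f \<in> pinj X Y" and R: "|R| <o |ran f|" by (auto simp: high_rank_def)
    then have XY: "dom f \<subseteq> X" "ran f \<subseteq> Y" by (auto simp: pinj_def)
    obtain \<mu> where \<mu>: "\<mu> \<in> cardinals_upto |Y|" "\<mu> =o |ran f|"
      using cardinals_upto_unique[OF card_of_Card_order card_of_Card_order card_of_mono1[OF XY(2)]] by blast
    have C: "Card_order \<mu>" using \<mu> cardinals_upto_Card_order by blast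
    have eqs: "|ran f| =o \<mu>" "|dom f| =o \<mu>"
      using \<mu>(2) pinj_finite_ran(3)[OF fp] ordIso_symmetric ordIso_transitive by blast+
    have "\<mu> \<in> I" using \<mu> R eqs ordLess_ordIso_trans by (auto simp: I_def)
    define h where "h = the \<circ> f"
    have h: "bij_betw h (dom f) (ran f)"
      unfolding h_def by (rule pinj_bij_betw[OF fp])
    define E where "E = inv_into (dom f) (e \<mu> (dom f))"
    define D where "D = inv_into (Field \<mu>) (d \<mu> (ran f))"
    note eb = e[OF C eqs(2)] and db = d[OF C eqs(1)]
    \<comment> \<open>The permutation that \<open>f\<close> induces on \<open>\<mu>\<close> once
      \<open>dom f\<close> and \<open>ran f\<close> are identified with it; \<open>permutes\<close>
      asks for the identity elsewhere.\<close>
    define p where "p = (\<lambda>z. if z \<in> Field \<mu> then D (h (E z)) else z)"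
    have "bij_betw (D \<circ> (h \<circ> E)) (Field \<mu>) (Field \<mu>)"
      using bij_betw_trans[OF bij_betw_trans[OF bij_betw_inv_into[OF eb] h] bij_betw_inv_into[OF db]]
      by (simp add: E_def D_def)
    then have "bij_betw p (Field \<mu>) (Field \<mu>)"
      by (rule bij_betw_cong[THEN iffD1, rotated]) (simp add: p_def)
    then have p: "p permutes Field \<mu>"
      by (rule bij_imp_permutes) (simp add: p_def)
    have "F (\<mu>, p, dom f, ran f) x = f x" for x
    proof (cases "x \<in> dom f")
      case True
      then have "E (e \<mu> (dom f) x) = x" "e \<mu> (dom f) x \<in> Field \<mu>" "h x \<in> ran f"
        using eb h by (auto simp: E_def bij_betw_def)
      moreover from this have "d \<mu> (ran f) (D (h x)) = h x"
        using db unfolding D_def bij_betw_def by (simp add: f_inv_into_f)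
      ultimately show ?thesis using True by (auto simp: F_def p_def h_def)
    next
      case False
      then show ?thesis by (simp add: F_def domIff)
    qed
    then have "f = F (\<mu>, p, dom f, ran f)" by (simp add: fun_eq_iff)
    moreover have "(\<mu>, p, dom f, ran f) \<in> S"
      unfolding S_def using \<open>\<mu> \<in> I\<close> p XY eqs by blast
    ultimately show "\<exists>s\<in>S. f = F s" by blast
  qed
  then show ?thesis unfolding I S by (rule card_of_ordIsoI)
qed

lemma semigroup_rank_pinj_less:
  fixes X :: "'x set" and Y :: "'y set"
  assumes a: "a \<in> pinj Y X" and fin: "finite (ran a)"
    and Y: "|ran a| <o |Y|" and X: "|Y| \<le>o |X|"
  shows "semigroup_rank (sandwich a) (pinj X Y) =o
    card_sum {\<mu> \<in> cardinals_upto |Y|. |ran a| +c cone \<le>o \<mu>}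
      (\<lambda>\<mu>. card_fact \<mu> *c card_binomial |X| \<mu> *c card_binomial |Y| \<mu>)"
proof -
  have "semigroup_rank (sandwich a) (pinj X Y) =o |high_rank (ran a) X Y|"
    by (rule semigroup_rank_eq[OF high_rank_generates[OF assms]])
      (rule card_of_mono1[OF high_rank_subset_generates])
  then show ?thesis
    using card_of_high_rank[OF fin] ordIso_symmetric ordIso_transitive by blast
qed

section \<open>Generators of the symmetric group\<close>

lemma generated_comp_funpow:
  assumes "c \<in> H" and "k > 0"
  shows "c ^^ k \<in> generated (\<circ>) H"
  using \<open>k > 0\<close>
proof (induction k)
  case (Suc k)
  have "c \<in> generated (\<circ>) H" using assms(1) by (rule generated.incl)
  then show ?case using Suc.IH generated.mult[of c "(\<circ>)" H "c ^^ k"]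
    by (metis comp_id funpow.simps gr0I)
qed simp

text \<open>Conjugation by \<open>c\<close> moves the given transposition along the orbit of
  \<open>y0\<close>, which covers \<open>S\<close>. The transpositions of neighbours so obtained
  yield those of \<open>y0\<close> with any point, then all transpositions, hence all
  permutations.\<close>

lemma permutes_generated:
  fixes c :: "'a \<Rightarrow> 'a"
  assumes c: "c permutes S" and fin: "finite S" and y0: "y0 \<in> S"
    and orbit: "\<And>y. y \<in> S \<Longrightarrow> \<exists>k. y = (c ^^ k) y0"
    and p: "p permutes S"
  shows "p \<in> generated (\<circ>) {Transposition.transpose y0 (c y0), c}"
proof -
  define H where "H = generated (\<circ>) {Transposition.transpose y0 (c y0), c}"
  have comp: "f \<circ> g \<in> H" if "f \<in> H" "g \<in> H" for f g
    using that unfolding H_def by (rule generated.mult)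
  have cH: "c \<in> H" and t0: "Transposition.transpose y0 (c y0) \<in> H"
    by (auto simp: H_def intro: generated.incl)
  \<comment> \<open>\<open>generated\<close> closes under products only; the finite order of
    \<open>c\<close> supplies the identity and the inverse as powers.\<close>
  obtain N where N: "N > 0" "c ^^ N = id"
    using permutation_is_nilpotent[of c] c fin permutation_permutes by metis
  have powH: "c ^^ k \<in> H" if "k > 0" for k
    unfolding H_def using that by (intro generated_comp_funpow) auto
  have idH: "id \<in> H" using powH[OF N(1)] N(2) by simp
  have bij: "bij c" by (rule permutes_bij[OF c])
  have "c ^^ (N - 1) \<circ> c = c ^^ N" using N(1) by (metis Suc_diff_1 funpow_Suc_right)
  then have "inv c = c ^^ (N - 1)"
    using N(2) bij by (metis bij_is_surj comp_assoc comp_id id_comp surj_iff)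
  \<comment> \<open>The exponent 0 is not covered by \<open>powH\<close>; in that case the inverse
    is the identity.\<close>
  then have invH: "inv c \<in> H" using powH idH by (cases "N - 1 = 0") simp_all
  have conj: "Transposition.transpose (c u) (c v) \<in> H" if "Transposition.transpose u v \<in> H" for u v
  proof -
    have "Transposition.transpose (c u) (c v) \<circ> c = c \<circ> Transposition.transpose u v"
      using bij by (simp add: fun_eq_iff transpose_apply_commute bij_is_inj)
    then have "c \<circ> Transposition.transpose u v \<circ> inv c = Transposition.transpose (c u) (c v)"
      using bij by (metis bij_is_surj comp_assoc comp_id surj_iff)
    then show ?thesis using comp[OF comp[OF cH that] invH] by simp
  qed
  have adj: "Transposition.transpose ((c ^^ k) y0) ((c ^^ Suc k) y0) \<in> H" for k
  proof (induction k)
    case 0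
    then show ?case using t0 by simp
  next
    case (Suc k)
    then show ?case using conj[OF Suc] by simp
  qed
  have star: "Transposition.transpose y0 ((c ^^ k) y0) \<in> H" for k
  proof (induction k)
    case 0
    then show ?case using idH by (simp add: id_def)
  next
    case (Suc k)
    \<comment> \<open>Conjugating the transposition of \<open>?z\<close> and \<open>?z'\<close> by
      that of \<open>y0\<close> and \<open>?z\<close> gives that of \<open>y0\<close> and
      \<open>?z'\<close>, unless \<open>?z'\<close> equals \<open>y0\<close> or
      \<open>?z\<close>.\<close>
    let ?z = "(c ^^ k) y0" and ?z' = "(c ^^ Suc k) y0"
    consider "y0 = ?z'" | "?z = ?z'" | "y0 \<noteq> ?z'" "?z \<noteq> ?z'" by blast
    then show ?case
    proof cases
      case 1
      then show ?thesis using idH by (metis transpose_same)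
    next
      case 2
      then show ?thesis using Suc by simp
    next
      case 3
      then show ?thesis
        using transpose_comp_triple[OF 3] comp[OF comp[OF Suc adj[of k]] Suc] by simp
    qed
  qed
  have trans: "Transposition.transpose u v \<in> H" if "u \<in> S" "v \<in> S" "u \<noteq> v" for u v
  proof -
    have u: "Transposition.transpose u y0 \<in> H" and v: "Transposition.transpose y0 v \<in> H"
      using star orbit[OF that(1)] orbit[OF that(2)] by (metis transpose_commute)+
    show ?thesis
    proof (cases "y0 = v")
      case True
      then show ?thesis using u by simp
    next
      case False
      then show ?thesis
        using transpose_comp_triple[OF that(3) False] comp[OF comp[OF u v] u] by simp
    qed
  qed
  have "p \<in> H" using p fin
  proof (induction rule: permutes_induct)
    case (swap u v q)
    then show ?case by (intro comp trans)
  qed (rule idH)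
  then show ?thesis by (simp add: H_def)
qed

text \<open>The cyclic successor on an enumeration of \<open>S\<close> by \<open>0..<n\<close>,
  rearranged by a transposition so that it starts with \<open>y0\<close>.\<close>

lemma exists_transitive_permutation:
  assumes fin: "finite S" and y0: "y0 \<in> S"
  shows "\<exists>c. c permutes S \<and> (\<forall>y\<in>S. \<exists>k. y = (c ^^ k) y0)"
proof -
  define n where "n = card S"
  have n: "n > 0" using assms by (auto simp: n_def card_gt_0_iff)
  obtain h0 where h0: "bij_betw h0 {0..<n} S" using ex_bij_betw_nat_finite[OF fin] by (auto simp: n_def)
  define h where "h = Transposition.transpose y0 (h0 0) \<circ> h0"
  have "h0 0 \<in> S" using h0 n by (auto simp: bij_betw_def)
  then have h: "bij_betw h {0..<n} S"
    unfolding h_def using y0 by (intro bij_betw_trans[OF h0] permutes_imp_bij permutes_swap_id)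
  have hy0: "h 0 = y0" by (simp add: h_def)
  define c where "c = (\<lambda>y. if y \<in> S then h (Suc (inv_into {0..<n} h y) mod n) else y)"
  have ch: "c (h i) = h (Suc i mod n)" if "i < n" for i
    using that h by (auto simp: c_def bij_betw_def)
  have pow: "(c ^^ k) y0 = h (k mod n)" for k
    by (induction k) (use n in \<open>auto simp: hy0 ch mod_Suc_eq\<close>)
  \<comment> \<open>A positive exponent makes \<open>y\<close> a value of \<open>c\<close> on the
    orbit, which gives surjectivity.\<close>
  have orb: "\<exists>k>0. y = (c ^^ k) y0" if y: "y \<in> S" for y
  proof -
    obtain i where i: "i < n" "y = h i" using h y by (auto simp: bij_betw_def)
    then have "y = (c ^^ (i + n)) y0" by (simp add: pow)
    then show ?thesis using n by (intro exI[of _ "i + n"]) simp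
  qed
  have "(c ^^ k) y0 \<in> S" for k
    using h n by (auto simp: pow bij_betw_def)
  then have "S \<subseteq> c ` S"
    using orb by (fastforce simp: gr0_conv_Suc)
  moreover have "c ` S \<subseteq> S" using h n by (auto simp: c_def bij_betw_def)
  ultimately have "bij_betw c S S"
    using fin by (simp add: bij_betw_def eq_card_imp_inj_on subset_antisym)
  then have "c permutes S" by (rule bij_imp_permutes) (simp add: c_def)
  then show ?thesis using orb by blast
qed

lemma permutes_two_generators:
  assumes "finite S"
  shows "\<exists>t c. t permutes S \<and> c permutes S \<and> {p. p permutes S} \<subseteq> generated (\<circ>) {t, c}"
proof (cases "S = {}")
  case True
  then show ?thesis by (intro exI[of _ id]) (auto intro: generated.incl)
next
  case False
  then obtain y0 where y0: "y0 \<in> S" by blast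
  then obtain c where c: "c permutes S" "\<And>y. y \<in> S \<Longrightarrow> \<exists>k. y = (c ^^ k) y0"
    using exists_transitive_permutation[OF assms] by blast
  have "c y0 \<in> S" using y0 c(1) by (simp add: permutes_in_image)
  then have "Transposition.transpose y0 (c y0) permutes S" using y0 by (intro permutes_swap_id)
  then show ?thesis using c permutes_generated[OF c(1) assms y0 c(2)] by blast
qed

text \<open>The group has at most two elements. If there are two, the identity is obtained as the
  square of the transposition.\<close>

lemma permutes_one_generator:
  assumes "finite S" "card S \<le> 2"
  shows "\<exists>t. t permutes S \<and> {p. p permutes S} \<subseteq> generated (\<circ>) {t}"
proof (cases "card S = 2")
  case True
  then obtain u v where S: "S = {u, v}" "u \<noteq> v" by (auto simp: card_2_iff)
  let ?t = "Transposition.transpose u v"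
  have "?t \<in> generated (\<circ>) {?t}" by (auto intro: generated.incl)
  moreover from this have "id \<in> generated (\<circ>) {?t}"
    using generated.mult[of ?t "(\<circ>)" "{?t}" ?t] by simp
  moreover have "p = id \<or> p = ?t" if "p permutes S" for p
    using that S by (simp add: permutes_doubleton_iff)
  ultimately show ?thesis using S by (intro exI[of _ ?t]) (auto simp: permutes_swap_id)
next
  case False
  then have "card S \<le> 1" using assms by simp
  then have "p = id" if "p permutes S" for p
    using that assms(1) by (metis card_le_Suc0_iff_eq One_nat_def permutes_in_image permutes_not_in eq_id_iff)
  then show ?thesis by (intro exI[of _ id]) (auto intro: generated.incl)
qed

text \<open>Two transpositions with one common point do not commute. In
  \<open>generating_set_two\<close> this excludes a single generator with domain
  \<open>ran a\<close>.\<close>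

lemma permutes_not_commute:
  assumes "card S \<ge> 3"
  shows "\<exists>p q. p permutes S \<and> q permutes S \<and> p \<circ> q \<noteq> q \<circ> p"
proof -
  obtain T where T: "T \<subseteq> S" "card T = 3" using obtain_subset_with_card_n[OF assms] by blast
  then obtain u v w where *: "u \<in> S" "v \<in> S" "w \<in> S" "u \<noteq> v" "v \<noteq> w" "u \<noteq> w"
    by (auto simp: card_3_iff)
  let ?p = "Transposition.transpose u v" and ?q = "Transposition.transpose v w"
  have "(?p \<circ> ?q) u \<noteq> (?q \<circ> ?p) u" using * by (simp add: Transposition.transpose_def)
  then show ?thesis using * by (metis permutes_swap_id)
qed

section \<open>The case of full rank\<close>

text \<open>The set counted by \<open>card_binomial |X| |Y|\<close>; for finite \<open>Y\<close> it
  consists of the domains of the elements onto \<open>Y\<close>.\<close>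

abbreviation n_subsets :: "'x set \<Rightarrow> 'y set \<Rightarrow> 'x set set" where
  "n_subsets X Y \<equiv> {A. A \<subseteq> X \<and> |A| =o |Y| }"

lemma finite_dom_ran_pinj:
  assumes "f \<in> pinj X Y" "finite Y"
  shows "finite (dom f)" "finite (ran f)" "card (ran f) \<le> card Y"
proof -
  have "ran f \<subseteq> Y" using assms(1) by (simp add: pinj_def)
  then show "finite (ran f)" "card (ran f) \<le> card Y"
    using assms(2) by (auto intro: finite_subset card_mono)
  then show "finite (dom f)" using pinj_finite_ran(1)[OF assms(1)] by simp
qed

text \<open>Domain and range are equinumerous, and no proper subset of a finite set has its size;
  full rank is thus visible from the domain.\<close>

lemma n_subsets_iff:
  assumes "f \<in> pinj X Y" "finite Y"
  shows "dom f \<in> n_subsets X Y \<longleftrightarrow> ran f = Y"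
proof
  assume "ran f = Y"
  then show "dom f \<in> n_subsets X Y" using assms pinj_finite_ran(3)[OF assms(1)] by (auto simp: pinj_def)
next
  assume "dom f \<in> n_subsets X Y"
  then have "card (dom f) = card Y"
    using card_of_ordIso bij_betw_same_card by blast
  then show "ran f = Y"
    using assms pinj_finite_ran(2)[OF assms(1)] by (auto simp: pinj_def card_subset_eq)
qed

lemma ex_pinj_dom:
  assumes A: "A \<in> n_subsets X Y"
  shows "\<exists>f\<in>pinj X Y. dom f = A"
proof -
  have "|A| =o |Y|" using A by simp
  then obtain h where h: "bij_betw h A Y" by (auto simp: card_of_ordIso[symmetric])
  define f where "f = (\<lambda>x. if x \<in> A then Some (h x) else None)"
  have "f \<in> pinj X Y"
    using h A by (intro pinjI) (auto simp: f_def bij_betw_def inj_on_def split: if_splits)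
  moreover have "dom f = A" by (auto simp: f_def dom_def)
  ultimately show ?thesis by blast
qed

section \<open>Upper bound: changing elements by permutations of the target\<close>

lemma post_pinj:
  assumes f: "f \<in> pinj X Y" and p: "p permutes Y"
  shows "map_option p \<circ> f \<in> pinj X Y"
proof (rule pinjI)
  show "x \<in> X \<and> y \<in> Y" if "(map_option p \<circ> f) x = Some y" for x y
    using that f permutes_in_image[OF p] by (auto simp: pinj_def ran_def)
  show "x = x'" if "(map_option p \<circ> f) x = Some y" "(map_option p \<circ> f) x' = Some y" for x x' y
    using that pinj_same[OF f] permutes_inj[OF p] by (auto dest: injD)
qed

text \<open>The inverse of \<open>a\<close> cancels \<open>a\<close>, which is defined on all values
  of \<open>f\<close>; thus any permutation can be applied by a right factor.\<close>

lemma sandwich_post: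
  assumes a: "a \<in> pinj Y X" and dom: "dom a = Y" and f: "f \<in> pinj X Y"
  shows "sandwich a f (map_option p \<circ> pinv a) = map_option p \<circ> f"
proof
  fix z
  show "sandwich a f (map_option p \<circ> pinv a) z = (map_option p \<circ> f) z"
  proof (cases "f z")
    case None
    then show ?thesis by (simp add: sandwich_def)
  next
    case (Some y)
    then have "y \<in> dom a" using f dom by (auto simp: pinj_def ran_def)
    then obtain x where "a y = Some x" by blast
    moreover from this have "pinv a x = Some y" using pinv_Some_iff[OF a] by blast
    ultimately show ?thesis using Some by (simp add: sandwich_def)
  qed
qed

text \<open>The permutation undoes \<open>g\<close> and then applies \<open>f\<close>, which is
  possible on all of \<open>Y\<close> because \<open>g\<close> is onto.\<close>

lemma factor_through_permutation:
  assumes f: "f \<in> pinj X Y" "ran f = Y" and g: "g \<in> pinj X Y" "ran g = Y" and dom: "dom f = dom g"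
  shows "\<exists>p. p permutes Y \<and> f = map_option p \<circ> g"
proof -
  define p where "p = (\<lambda>y. if y \<in> Y then (the \<circ> f) (inv_into (dom g) (the \<circ> g) y) else y)"
  have fb: "bij_betw (the \<circ> f) (dom g) Y" using pinj_bij_betw[OF f(1)] f(2) dom by simp
  have gb: "bij_betw (the \<circ> g) (dom g) Y" using pinj_bij_betw[OF g(1)] g(2) by simp
  have "bij_betw p Y Y"
    using bij_betw_trans[OF bij_betw_inv_into[OF gb] fb]
    by (rule bij_betw_cong[THEN iffD1, rotated]) (simp add: p_def)
  then have "p permutes Y" by (rule bij_imp_permutes) (simp add: p_def)
  moreover have "f x = (map_option p \<circ> g) x" for x
  proof (cases "x \<in> dom g")
    case True
    then have "inv_into (dom g) (the \<circ> g) (the (g x)) = x"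
      using bij_betw_inv_into_left[OF gb True] by simp
    moreover have "the (g x) \<in> Y" using gb True by (auto simp: bij_betw_def)
    moreover obtain y z where "g x = Some y" "f x = Some z" using True dom by blast
    ultimately show ?thesis by (simp add: p_def)
  next
    case False
    then have "g x = None" "f x = None" using dom by (auto simp: domIff)
    then show ?thesis by simp
  qed
  ultimately show ?thesis by blast
qed

text \<open>An element onto \<open>Y\<close> differs from the generator with the same domain by a
  permutation, and \<open>P\<close> makes every permutation available as a right factor.\<close>

lemma generates_if_total:
  fixes a :: "'y \<rightharpoonup> 'x"
  assumes a: "a \<in> pinj Y X" and fin: "finite Y" and dom: "dom a = Y" and ne: "ran a \<noteq> X"
    and G: "G \<subseteq> pinj X Y" and doms: "\<And>A. A \<in> n_subsets X Y \<Longrightarrow> \<exists>g\<in>G. dom g = A"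
    and P: "{p. p permutes Y} \<subseteq> generated (\<circ>) P" "P \<subseteq> {p. p permutes Y}"
      "\<And>p. p \<in> P \<Longrightarrow> map_option p \<circ> pinv a \<in> G"
  shows "generates (sandwich a) (pinj X Y) G"
proof (rule generates_pinjI[OF a ne G])
  have perm: "p permutes Y \<and> map_option p \<circ> pinv a \<in> generated (sandwich a) G" if "p \<in> generated (\<circ>) P" for p
    using that
  proof induction
    case (incl s)
    then show ?case using P(2) by (intro conjI generated.incl P(3)) blast+
  next
    case (mult s t)
    have "map_option t \<circ> pinv a \<in> pinj X Y" by (rule post_pinj[OF pinv_pinj[OF a] conjunct1[OF mult.IH(2)]])
    \<comment> \<open>The factors stand in reverse order: \<open>sandwich\<close> composes from left
      to right, \<open>\<circ>\<close> from right to left.\<close>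
    then have "sandwich a (map_option t \<circ> pinv a) (map_option s \<circ> pinv a)
      = map_option s \<circ> (map_option t \<circ> pinv a)" by (rule sandwich_post[OF a dom])
    also have "\<dots> = map_option (s \<circ> t) \<circ> pinv a"
      by (simp add: fun_eq_iff option.map_comp)
    finally show ?case using mult.IH permutes_compose by (metis generated.mult)
  qed
  fix f assume f: "f \<in> pinj X Y" "\<not> (finite (ran f) \<and> card (ran f) \<le> card (ran a) \<and> ran f \<noteq> Y)"
  have "card (ran a) = card Y" using pinj_finite_ran(2)[OF a] dom by simp
  then have ran: "ran f = Y" using f finite_dom_ran_pinj[OF f(1) fin] by auto
  then have "dom f \<in> n_subsets X Y" using n_subsets_iff[OF f(1) fin] by simp
  then obtain g where g: "g \<in> G" "dom g = dom f" using doms by blast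
  then have gp: "g \<in> pinj X Y" using G by blast
  then have "ran g = Y" using n_subsets_iff[OF gp fin] g(2) \<open>dom f \<in> n_subsets X Y\<close> by simp
  then obtain p where p: "p permutes Y" "f = map_option p \<circ> g"
    using factor_through_permutation[OF f(1) ran gp] g(2) by metis
  then have "f = sandwich a g (map_option p \<circ> pinv a)" using sandwich_post[OF a dom gp] by simp
  moreover have "map_option p \<circ> pinv a \<in> generated (sandwich a) G" using perm P(1) p(1) by blast
  ultimately show "f \<in> generated (sandwich a) G" using g(1) by (metis generated.incl generated.mult)
qed

section \<open>Lower bound: domains of the factors\<close>

lemma dom_sandwich_subset: "dom (sandwich a f g) \<subseteq> dom f"
  by (auto simp: sandwich_def map_comp_Some_iff)

text \<open>The product loses no point of \<open>f\<close>, for sizes leave no room. So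
  \<open>f\<close> is onto \<open>Y\<close>, each value of \<open>a\<close> has to be carried on by
  \<open>g\<close>, and counting gives \<open>dom g = ran a\<close>.\<close>

lemma sandwich_dom_eq:
  fixes a :: "'y \<rightharpoonup> 'x"
  assumes a: "a \<in> pinj Y X" and fin: "finite Y" and dom: "dom a = Y"
    and f: "f \<in> pinj X Y" and g: "g \<in> pinj X Y" and A: "dom (sandwich a f g) \<in> n_subsets X Y"
  shows "dom f = dom (sandwich a f g)" and "dom g = ran a"
proof -
  let ?s = "sandwich a f g"
  have s: "?s \<in> pinj X Y" using sandwich_closed[OF a f g] .
  have "ran ?s = Y" using n_subsets_iff[OF s fin] A by simp
  moreover have "ran ?s \<subseteq> ran g" "ran g \<subseteq> Y"
    using g by (auto simp: ran_def sandwich_def map_comp_Some_iff pinj_def)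
  ultimately have rg: "ran g = Y" by blast
  have cs: "card (dom ?s) = card Y" using \<open>ran ?s = Y\<close> pinj_finite_ran(2)[OF s] by simp
  have "card (dom f) \<le> card Y"
    using finite_dom_ran_pinj[OF f fin] pinj_finite_ran(2)[OF f] by simp
  then show df: "dom f = dom ?s"
    using card_seteq[OF finite_dom_ran_pinj(1)[OF f fin] dom_sandwich_subset] cs by metis
  have "ran a \<subseteq> dom g"
  proof
    fix x assume "x \<in> ran a"
    then obtain y where y: "a y = Some x" by (auto simp: ran_def)
    then have "y \<in> Y" using dom by auto
    moreover have "ran f = Y" using n_subsets_iff[OF f fin] A df by simp
    ultimately obtain z where z: "f z = Some y" by (auto simp: ran_def)
    then have "z \<in> dom ?s" using df by auto
    then show "x \<in> dom g" using y z by (auto simp: sandwich_def map_comp_Some_iff)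
  qed
  moreover have "card (dom g) = card (ran a)"
    using rg pinj_finite_ran(2)[OF g] pinj_finite_ran(2)[OF a] dom by simp
  ultimately show "dom g = ran a"
    using finite_dom_ran_pinj(1)[OF g fin] by (metis card_subset_eq)
qed

text \<open>In a product of full rank the first factor keeps the domain; descending to the leftmost
  generator finds the required one.\<close>

lemma generating_set_dom:
  fixes a :: "'y \<rightharpoonup> 'x"
  assumes a: "a \<in> pinj Y X" and fin: "finite Y" and dom: "dom a = Y"
    and B: "generates (sandwich a) (pinj X Y) B" and A: "A \<in> n_subsets X Y"
  shows "\<exists>g\<in>B. dom g = A"
proof -
  have gen: "generated (sandwich a) B = pinj X Y" using B by (simp add: generates_def)
  have *: "\<exists>g\<in>B. dom g = dom s" if "s \<in> generated (sandwich a) B" "dom s \<in> n_subsets X Y" for s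
    using that
  proof induction
    case (mult s t)
    then have eq: "dom s = dom (sandwich a s t)"
      using sandwich_dom_eq(1)[OF a fin dom] gen by blast
    then have "dom s \<in> n_subsets X Y" using mult.prems by (simp only: eq)
    then show ?case using mult.IH(1) unfolding eq by blast
  next
    case (incl s)
    then show ?case by (intro bexI[of _ s] refl)
  qed
  obtain f where "f \<in> pinj X Y" "dom f = A" using ex_pinj_dom[OF A] by blast
  then show ?thesis using *[of f] A gen by auto
qed

text \<open>The elements with domain \<open>ran a\<close> form a copy of the symmetric group on \<open>Y\<close>, and a
  product of two elements lies in this group only if both factors do; were there only one
  generator with this domain, the group would be commutative.\<close>

lemma generating_set_two:
  fixes a :: "'y \<rightharpoonup> 'x"
  assumes a: "a \<in> pinj Y X" and fin: "finite Y" and dom: "dom a = Y" and card: "card Y \<ge> 3"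
    and B: "generates (sandwich a) (pinj X Y) B"
  shows "\<exists>g\<in>B. \<exists>h\<in>B. g \<noteq> h \<and> dom g = ran a \<and> dom h = ran a"
proof (rule ccontr)
  assume contra: "\<not> ?thesis"
  let ?m = "sandwich a"
  have gen: "generated ?m B = pinj X Y" using B by (simp add: generates_def)
  have ran: "ran a \<in> n_subsets X Y"
    using a dom pinj_finite_ran(3)[OF a] ordIso_symmetric by (auto simp: pinj_def)
  have eq: "g = h" if "g \<in> B" "h \<in> B" "dom g = ran a" "dom h = ran a" for g h
    using contra that by blast
  \<comment> \<open>Commuting with the generators of domain \<open>ran a\<close> passes to products
    by associativity, since both factors of a product with this domain have it too.\<close>
  have closed: "?m u s = ?m s u"
    if base: "\<And>g. g \<in> B \<Longrightarrow> dom g = ran a \<Longrightarrow> ?m u g = ?m g u"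
      and "s \<in> generated ?m B" "dom s = ran a" for u s
    using that(2,3)
  proof induction
    case (incl s)
    then show ?case using base by blast
  next
    case (mult s t)
    have "dom s = ran a" "dom t = ran a"
      using sandwich_dom_eq[OF a fin dom, of s t] mult gen ran by auto
    then have "?m u s = ?m s u" "?m u t = ?m t u" using mult.IH by auto
    then show ?case by (metis sandwich_assoc)
  qed
  \<comment> \<open>\<open>closed\<close> is used twice: the outer use reduces \<open>t\<close> to a
    generator \<open>g\<close>, the inner one reduces \<open>s\<close> to a generator, which equals
    \<open>g\<close>.\<close>
  have comm: "?m s t = ?m t s" if s: "s \<in> pinj X Y" "dom s = ran a" and t: "t \<in> pinj X Y" "dom t = ran a" for s t
  proof (rule closed)
    fix g assume g: "g \<in> B" "dom g = ran a"
    have "?m g s = ?m s g"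
    proof (rule closed)
      show "?m g h = ?m h g" if "h \<in> B" "dom h = ran a" for h using eq[OF that(1) g(1) that(2) g(2)] by simp
    qed (use s gen in auto)
    then show "?m s g = ?m g s" by simp
  qed (use t gen in auto)
  obtain p q where pq: "p permutes Y" "q permutes Y" "p \<circ> q \<noteq> q \<circ> p"
    using permutes_not_commute[OF card] by blast
  let ?b = "\<lambda>p. map_option p \<circ> pinv a"
  have bp: "?b r \<in> pinj X Y" "dom (?b r) = ran a" if "r permutes Y" for r
    using post_pinj[OF pinv_pinj[OF a] that] dom_pinv[OF a] by (auto simp: dom_def)
  have "?m (?b p) (?b q) = map_option q \<circ> ?b p" "?m (?b q) (?b p) = map_option p \<circ> ?b q"
    using sandwich_post[OF a dom bp(1)[OF pq(1)]] sandwich_post[OF a dom bp(1)[OF pq(2)]] by auto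
  then have e: "map_option q \<circ> ?b p = map_option p \<circ> ?b q"
    using comm[OF bp[OF pq(1)] bp[OF pq(2)]] by simp
  have "(p \<circ> q) y = (q \<circ> p) y" for y
  proof (cases "y \<in> Y")
    case True
    then obtain x where "a y = Some x" using dom by blast
    then have "pinv a x = Some y" using pinv_Some_iff[OF a] by blast
    then show ?thesis using fun_cong[OF e, of x] by simp
  next
    case False
    then show ?thesis using pq(1,2) by (simp add: permutes_not_in)
  qed
  then show False using pq(3) by blast
qed

text \<open>A choice of one element per label contains at most one of two elements with equal label;
  the one left out takes the extra point of \<open>E\<close>.\<close>

lemma n_subsets_plus_ordLeq:
  fixes E :: "unit set"
  assumes f: "\<And>A. A \<in> S \<Longrightarrow> \<exists>g\<in>B. d g = A"
    and E: "E \<noteq> {} \<Longrightarrow> \<exists>g\<in>B. \<exists>h\<in>B. g \<noteq> h \<and> d g = d h"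
  shows "|S <+> E| \<le>o |B|"
proof -
  obtain b where b: "\<And>A. A \<in> S \<Longrightarrow> b A \<in> B \<and> d (b A) = A" using f by metis
  obtain h where h: "E \<noteq> {} \<Longrightarrow> h \<in> B \<and> h \<notin> b ` S"
    using E b by (metis imageE)
  let ?F = "case_sum b (\<lambda>_. h)"
  have "inj_on ?F (S <+> E)"
  proof (rule inj_onI)
    fix u v assume u: "u \<in> S <+> E" and v: "v \<in> S <+> E" and e: "?F u = ?F v"
    show "u = v"
    proof (cases u; cases v)
      fix A A' assume "u = Inl A" "v = Inl A'"
      then show "u = v" using u v e b by (metis InlI Inl_inject PlusE old.sum.distinct(1) old.sum.simps(5))
    next
      fix A x assume "u = Inl A" "v = Inr x"
      then show "u = v" using u v e h by auto
    next
      fix A x assume "u = Inr x" "v = Inl A"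
      then show "u = v" using u v e h by force
    next
      fix x y :: unit assume "u = Inr x" "v = Inr y"
      then show "u = v" by simp
    qed
  qed
  moreover have "?F ` (S <+> E) \<subseteq> B" using b h by fastforce
  ultimately show ?thesis using card_of_ordLeq by blast
qed

lemma semigroup_rank_pinj_eq:
  fixes X :: "'x set" and Y :: "'y set" and a :: "'y \<rightharpoonup> 'x"
  assumes a: "a \<in> pinj Y X" and fin: "finite Y" and dom: "dom a = Y" and ne: "ran a \<noteq> X"
  shows "semigroup_rank (sandwich a) (pinj X Y) =o
    |n_subsets X Y <+> (if card Y \<le> 2 then {} else UNIV :: unit set)|"
proof -
  let ?E = "if card Y \<le> 2 then {} else UNIV :: unit set"
  have ran: "ran a \<in> n_subsets X Y"
    using a dom pinj_finite_ran(3)[OF a] ordIso_symmetric by (auto simp: pinj_def)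
  \<comment> \<open>The image of \<open>?E\<close> under the constant map \<open>c\<close> is empty
    or \<open>{c}\<close>, so one statement covers one and two generators.\<close>
  obtain t c where t: "t permutes Y" and c: "card Y > 2 \<Longrightarrow> c permutes Y"
    and gen: "{p. p permutes Y} \<subseteq> generated (\<circ>) ({t} \<union> (\<lambda>_. c) ` ?E)"
  proof (cases "card Y \<le> 2")
    case True
    then show ?thesis using that permutes_one_generator[OF fin True] by auto
  next
    case False
    then show ?thesis using that permutes_two_generators[OF fin] by (auto simp: UNIV_unit)
  qed
  let ?b = "\<lambda>p. map_option p \<circ> pinv a"
  have b: "?b p \<in> pinj X Y" if "p permutes Y" for p
    using post_pinj[OF pinv_pinj[OF a] that] .
  have b_dom: "dom (?b p) = ran a" for p using dom_pinv[OF a] by (auto simp: dom_def)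
  have "\<forall>A\<in>n_subsets X Y. \<exists>f. f \<in> pinj X Y \<and> dom f = A" using ex_pinj_dom by blast
  from bchoice[OF this] obtain e where e: "\<forall>A\<in>n_subsets X Y. e A \<in> pinj X Y \<and> dom (e A) = A" ..
  \<comment> \<open>The first group generator also serves as the element with domain
    \<open>ran a\<close>, so only \<open>c\<close> adds to the binomial coefficient.\<close>
  define e' where "e' = e(ran a := ?b t)"
  define G where "G = e' ` n_subsets X Y \<union> (\<lambda>_. ?b c) ` ?E"
  have e': "e' A \<in> pinj X Y" "dom (e' A) = A" if "A \<in> n_subsets X Y" for A
    using bspec[OF e that] b[OF t] b_dom[of t] by (simp_all add: e'_def)
  have G: "generates (sandwich a) (pinj X Y) G"
  proof (rule generates_if_total[OF a fin dom ne _ _ gen])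
    show "G \<subseteq> pinj X Y" using e' b c by (auto simp: G_def)
    show "\<exists>g\<in>G. dom g = A" if "A \<in> n_subsets X Y" for A
      using e'(2)[OF that] that unfolding G_def by blast
    show "{t} \<union> (\<lambda>_. c) ` ?E \<subseteq> {p. p permutes Y}" using t c by auto
    have "?b t \<in> G" unfolding G_def e'_def using ran by (intro UnI1 image_eqI[of _ _ "ran a"]) auto
    then show "?b p \<in> G" if "p \<in> {t} \<union> (\<lambda>_. c) ` ?E" for p
      using that by (auto simp: G_def)
  qed
  have lower: "|n_subsets X Y <+> ?E| \<le>o |B|" if B: "generates (sandwich a) (pinj X Y) B" for B
  proof (rule n_subsets_plus_ordLeq[where d = dom])
    show "\<exists>g\<in>B. dom g = A" if "A \<in> n_subsets X Y" for A
      by (rule generating_set_dom[OF a fin dom B that])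
    assume "?E \<noteq> {}"
    then have "card Y \<ge> 3" by (simp split: if_splits)
    then show "\<exists>g\<in>B. \<exists>h\<in>B. g \<noteq> h \<and> dom g = dom h"
      using generating_set_two[OF a fin dom _ B] by metis
  qed
  have "G = case_sum e' (\<lambda>_. ?b c) ` (n_subsets X Y <+> ?E)"
    unfolding G_def Plus_def by (simp add: image_Un image_image)
  \<comment> \<open>An inequality suffices here, as \<open>lower\<close> applied to \<open>G\<close>
    gives the other one.\<close>
  then have upper: "|G| \<le>o |n_subsets X Y <+> ?E|" by (simp only: card_of_image)
  have "semigroup_rank (sandwich a) (pinj X Y) =o |G|"
    by (rule semigroup_rank_eq[OF G]) (rule ordLeq_transitive[OF upper lower])
  moreover have "|G| =o |n_subsets X Y <+> ?E|"
    using upper lower[OF G] unfolding ordIso_iff_ordLeq ..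
  ultimately show ?thesis by (rule ordIso_transitive)
qed

theorem theorem4p3:
  fixes X :: "'x set" and Y :: "'y set" and a :: "'y \<rightharpoonup> 'x" and \<alpha> :: "'x rel"
  assumes a: "a \<in> pinj Y X" and \<alpha>: "\<alpha> = map_rank a"
  shows "(\<alpha> <o |Y| \<and> |Y| \<le>o |X| \<and> |X| \<le>o natLeq \<longrightarrow>
            semigroup_rank (sandwich a) (pinj X Y) =o
              card_sum {\<mu> \<in> cardinals_upto |Y|. \<alpha> +c cone \<le>o \<mu>}
                (\<lambda>\<mu>. card_fact \<mu> *c card_binomial |X| \<mu> *c card_binomial |Y| \<mu>))
       \<and> (\<alpha> =o |Y| \<and> |Y| <o |X| \<and> |X| \<le>o natLeq \<longrightarrow>
            semigroup_rank (sandwich a) (pinj X Y) =o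
              card_binomial |X| |Y| +c (if \<alpha> \<le>o ctwo then czero else cone))"
proof (intro conjI impI; elim conjE)
  assume Y: "\<alpha> <o |Y|" and X: "|Y| \<le>o |X|" "|X| \<le>o natLeq"
  \<comment> \<open>\<open>Y\<close> may be infinite, but it is countable and
    \<open>\<alpha>\<close> is strictly smaller.\<close>
  have "finite (ran a)"
    using finite_of_ordLess_natLeq[of "ran a" Y] Y ordLeq_transitive[OF X]
    by (simp add: \<alpha> map_rank_def)
  then show "semigroup_rank (sandwich a) (pinj X Y) =o
      card_sum {\<mu> \<in> cardinals_upto |Y|. \<alpha> +c cone \<le>o \<mu>}
        (\<lambda>\<mu>. card_fact \<mu> *c card_binomial |X| \<mu> *c card_binomial |Y| \<mu>)"
    using semigroup_rank_pinj_less[OF a _ _ X(1)] Y unfolding \<alpha> map_rank_def by blast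
next
  assume eq: "\<alpha> =o |Y|" and YX: "|Y| <o |X|" and X: "|X| \<le>o natLeq"
  have fin: "finite Y" by (rule finite_of_ordLess_natLeq[OF YX X])
  have eq': "|ran a| =o |Y|" using eq by (simp add: \<alpha> map_rank_def)
  then have "|dom a| =o |Y|" using pinj_finite_ran(3)[OF a] ordIso_transitive by blast
  then have "card (dom a) = card Y" using card_of_ordIso bij_betw_same_card by blast
  then have dom: "dom a = Y" using a fin by (simp add: pinj_def card_subset_eq)
  have ne: "ran a \<noteq> X" using ordIso_ordLess_trans[OF eq' YX] ordLess_irreflexive[of "|X|"] by auto
  \<comment> \<open>\<open>ctwo\<close> is the cardinality of \<open>bool\<close>.\<close>
  have "|ran a| \<le>o |UNIV :: bool set| \<longleftrightarrow> card Y \<le> 2"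
    using card_of_ordLeq_card[of "ran a" "UNIV :: bool set"] pinj_finite_ran(1,2)[OF a] dom fin by simp
  then have two: "\<alpha> \<le>o ctwo \<longleftrightarrow> card Y \<le> 2" by (simp add: \<alpha> map_rank_def ctwo_def)
  have "card_binomial |X| |Y| +c (if \<alpha> \<le>o ctwo then czero else cone) =
      |n_subsets X Y <+> (if card Y \<le> 2 then {} else UNIV :: unit set)|"
    by (simp add: two csum_def card_binomial_def czero_def cone_def Field_card_of UNIV_unit)
  then show "semigroup_rank (sandwich a) (pinj X Y) =o
      card_binomial |X| |Y| +c (if \<alpha> \<le>o ctwo then czero else cone)"
    using semigroup_rank_pinj_eq[OF a fin dom ne] by simp
qed

end
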